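(* In two dimensions, the family $\{A^4_\varepsilon\}_{\varepsilon>0}$ of $4$-averages over the vertices of a regular hexagon of radius $\varepsilon$ has the asymptotic mean value property for the $4$-Laplacian with constant $c_{4,2}=\tfrac12$. That is: let $\Omega\subset\mathbb{R}^2$ be a bounded domain, and let $\Omega_E=\{x\in\mathbb{R}^2:\operatorname{dist}(x,\Omega)<1\}$. For every $\phi\in C_b^\infty(\Omega_E)$ with $\nabla\phi\neq0$ everywhere on $\Omega_E$, $$\phi(x)=A^4_\varepsilon[\phi](x)+\tfrac12\,\varepsilon^2\left(-\Delta_4^G\phi(x)\right)+o(\varepsilon^2)\quad\text{as }\varepsilon\to0^+,$$ uniformly for $x\in\Omega$.
   Context: $C_b^\infty(\Omega_E)$ denotes the smooth functions on $\Omega_E$ which are bounded together with all their derivatives. For $x\in\Omega$ and $\varepsilon>0$ small enough that the closed ball of radius $\varepsilon$ about $x$ lies in $\Omega_E$, $A^4_\varepsilon[\phi](x)$ is the unique minimizer over $c\in\mathbb{R}$ of $\sum_{j=0}^{5}|\phi(x+\xi_j)-c|^4$, where $\xi_j=\varepsilon\left(\cos\frac{2\pi j}{6},\sin\frac{2\pi j}{6}\right)$, $j=0,\dots,5$. The game (normalized) $p$-Laplacian of a smooth function $u$ at points where $\nabla u\ne0$ is $$\Delta_p^Gu=\frac1p|\nabla u|^{2-p}\operatorname{div}(|\nabla u|^{p-2}\nabla u)=\frac1p\Delta u+\frac{p-2}{p}|\nabla u|^{-2}\sum_{i,j}\frac{\partial u}{\partial x_i}\frac{\partial u}{\partial x_j}\frac{\partial^2u}{\partial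 x_i\partial x_j}.$$ *)

theory Defs
  imports "HOL-Analysis.Analysis"
begin

definition partial_deriv :: "'n \<Rightarrow> (real ^ 'n \<Rightarrow> real) \<Rightarrow> real ^ 'n \<Rightarrow> real"
  where "partial_deriv i f x = frechet_derivative f (at x) (axis i 1)"

fun partial_derivs :: "'n list \<Rightarrow> (real ^ 'n \<Rightarrow> real) \<Rightarrow> real ^ 'n \<Rightarrow> real"
  where
    "partial_derivs [] f = f"
  | "partial_derivs (i # is) f = partial_deriv i (partial_derivs is f)"

text \<open>Meant for open \<open>S\<close>: all iterated partial derivatives exist and are (Frechet)
  differentiable, hence continuous, on \<open>S\<close>. As \<open>partial_deriv\<close> only depends on the germ of
  the function, the values of \<open>f\<close> outside \<open>S\<close> are irrelevant. The case \<open>is = []\<close> covers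
  \<open>f\<close> itself.\<close>

definition Cb_infinity :: "(real ^ 'n) set \<Rightarrow> (real ^ 'n \<Rightarrow> real) set"
  where "Cb_infinity S =
    {f. \<forall>is. partial_derivs is f differentiable_on S \<and> bounded (partial_derivs is f ` S)}"

definition gradient :: "(real ^ 'n \<Rightarrow> real) \<Rightarrow> real ^ 'n \<Rightarrow> real ^ 'n"
  where "gradient u x = (\<chi> i. partial_deriv i u x)"

definition divergence :: "(real ^ 'n \<Rightarrow> real ^ 'n) \<Rightarrow> real ^ 'n \<Rightarrow> real"
  where "divergence F x = (\<Sum>i\<in>UNIV. partial_deriv i (\<lambda>y. F y $ i) x)"

text \<open>Only meaningful at points where the gradient of \<open>u\<close> does not vanish.\<close>

definition game_laplacian :: "real \<Rightarrow> (real ^ 'n \<Rightarrow> real) \<Rightarrow> real ^ 'n \<Rightarrow> real"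
  where "game_laplacian p u x =
    1 / p * norm (gradient u x) powr (2 - p)
      * divergence (\<lambda>y. (norm (gradient u y) powr (p - 2)) *\<^sub>R gradient u y) x"

definition hexagon_vertex :: "real \<Rightarrow> nat \<Rightarrow> real ^ 2"
  where "hexagon_vertex \<epsilon> j =
    \<epsilon> *\<^sub>R vector [cos (2 * pi * real j / 6), sin (2 * pi * real j / 6)]"

definition hexagon_average4 :: "real \<Rightarrow> (real ^ 2 \<Rightarrow> real) \<Rightarrow> real ^ 2 \<Rightarrow> real"
  where "hexagon_average4 \<epsilon> \<phi> x =
    (THE c. is_arg_min (\<lambda>c. \<Sum>j=0..5. \<bar>\<phi> (x + hexagon_vertex \<epsilon> j) - c\<bar> ^ 4) (\<lambda>_. True) c)"

text \<open>For nonempty \<open>\<Omega>\<close>; \<open>infdist x {} = 0\<close> by convention.\<close>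

definition unit_enlargement :: "'a::metric_space set \<Rightarrow> 'a set"
  where "unit_enlargement \<Omega> = {x. infdist x \<Omega> < 1}"

end

theory Submission
  imports Defs
begin

text \<open>
  Write \<open>e\<^sub>j\<close> for the vertices of the unit hexagon, \<open>g\<close> for the gradient and \<open>H\<close> for the Hessian
  of \<open>\<phi>\<close> at \<open>x\<close>. The quartic average is the only root \<open>c\<close> of the derivative condition
  \<open>\<Sum>\<^sub>j (\<phi>(x + \<epsilon> e\<^sub>j) - c)\<^sup>3 = 0\<close> (lemma \<open>quartic_average_root\<close>). Put \<open>t = c - \<phi>(x)\<close> and expand
  \<open>\<phi>(x + \<epsilon> e\<^sub>j) - \<phi>(x) = \<epsilon> l\<^sub>j + \<epsilon>\<^sup>2 q\<^sub>j + O(\<epsilon>\<^sup>3)\<close> with \<open>l\<^sub>j = g \<bullet> e\<^sub>j\<close> and \<open>2 q\<^sub>j = e\<^sub>j \<bullet> H e\<^sub>j\<close>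
  (lemma \<open>taylor_second_order\<close>). The term of order \<open>\<epsilon>\<^sup>3\<close> in the sum of cubes is \<open>\<Sum>\<^sub>j l\<^sub>j\<^sup>3\<close>, which
  vanishes because the hexagon is symmetric about its centre. The term of order \<open>\<epsilon>\<^sup>4\<close> is
  \<open>3 \<Sum>\<^sub>j l\<^sub>j\<^sup>2 (q\<^sub>j - t/\<epsilon>\<^sup>2)\<close>, so to leading order \<open>t = \<epsilon>\<^sup>2 s\<close>, where \<open>s\<close> is the average of the \<open>q\<^sub>j\<close> with
  weights \<open>l\<^sub>j\<^sup>2\<close>. Lemma \<open>sum_cubes_root_expansion\<close> makes this quantitative, with an error at most
  a constant times \<open>\<epsilon>\<^sup>3\<close>.

  The moments of the hexagon up to degree four agree with those of the circle: the weights add up to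
  \<open>3 |g|\<^sup>2\<close> and \<open>\<Sum>\<^sub>j l\<^sub>j\<^sup>2 q\<^sub>j\<close> is \<open>3/8 (|g|\<^sup>2 tr H + 2 g \<bullet> H g)\<close>. Hence
  \<open>s = tr H / 8 + g \<bullet> H g / (4 |g|\<^sup>2)\<close>, which is half the game Laplacian for \<open>p = 4\<close>.

  Uniformity holds because the constants depend only on a bound for the derivatives of \<open>\<phi>\<close> up to
  order three and on a positive lower bound for \<open>|g|\<close>. The latter exists since the closure of
  \<open>\<Omega>\<close> is a compact subset of the unit enlargement.
\<close>

section \<open>Partial derivatives and Taylor expansion\<close>

lemma partial_derivs_has_derivative:
  fixes f :: "real ^ 'n \<Rightarrow> real"
  assumes "open S" "f \<in> Cb_infinity S" "x \<in> S"
  shows "(partial_derivs is f has_derivative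
    (\<lambda>v. \<Sum>i\<in>UNIV. v $ i * partial_derivs (i # is) f x)) (at x)"
proof -
  let ?D = "frechet_derivative (partial_derivs is f) (at x)"
  have "partial_derivs is f differentiable (at x)"
    using assms by (auto simp: Cb_infinity_def differentiable_on_eq_differentiable_at)
  then have D: "(partial_derivs is f has_derivative ?D) (at x)"
    by (simp add: frechet_derivative_works)
  then have lin: "linear ?D"
    by (rule has_derivative_linear)
  have "?D v = (\<Sum>i\<in>UNIV. v $ i * partial_derivs (i # is) f x)" for v
  proof -
    have "?D v = ?D (\<Sum>i\<in>UNIV. v $ i *\<^sub>R axis i 1)"
      using basis_expansion[of v] by (simp add: scalar_mult_eq_scaleR)
    also have "\<dots> = (\<Sum>i\<in>UNIV. v $ i * ?D (axis i 1))"
      by (simp add: linear_sum[OF lin] linear_scale[OF lin])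
    finally show ?thesis
      by (simp add: partial_deriv_def)
  qed
  then have "?D = (\<lambda>v. \<Sum>i\<in>UNIV. v $ i * partial_derivs (i # is) f x)"
    by blast
  with D show ?thesis
    by simp
qed

text \<open>
  Applied repeatedly, this expresses every derivative of a function along a line through its
  iterated partial derivatives.
\<close>

lemma partial_derivs_along_line:
  fixes f :: "real ^ 'n \<Rightarrow> real"
  assumes "open S" "f \<in> Cb_infinity S" "x + t *\<^sub>R v \<in> S"
  shows "((\<lambda>t. partial_derivs is f (x + t *\<^sub>R v)) has_real_derivative
    (\<Sum>i\<in>UNIV. v $ i * partial_derivs (i # is) f (x + t *\<^sub>R v))) (at t)"
proof -
  have "((\<lambda>t. x + t *\<^sub>R v) has_derivative (\<lambda>h. h *\<^sub>R v)) (at t)"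
    by (auto intro!: derivative_eq_intros)
  from has_derivative_compose[OF this partial_derivs_has_derivative[OF assms, where ?is = "is"]]
  show ?thesis
    unfolding has_field_derivative_def
    by (rule has_derivative_eq_rhs) (simp add: fun_eq_iff sum_distrib_left mult_ac)
qed

text \<open>
  The one-variable Taylor formula with Lagrange remainder, applied along the segment from \<open>x\<close> to
  \<open>x + v\<close>. The remainder is a sixth of a sum of \<open>CARD('n) ^ 3\<close> terms, each at most \<open>r ^ 3 * B\<close>.
\<close>

lemma taylor_second_order:
  fixes f :: "real ^ 'n \<Rightarrow> real"
  assumes S: "open S" "f \<in> Cb_infinity S"
    and seg: "\<And>t. 0 \<le> t \<Longrightarrow> t \<le> 1 \<Longrightarrow> x + t *\<^sub>R v \<in> S"
    and B: "\<And>i j k y. y \<in> S \<Longrightarrow> \<bar>partial_derivs [i, j, k] f y\<bar> \<le> B"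
    and r: "\<And>i. \<bar>v $ i\<bar> \<le> r"
  shows "\<bar>f (x + v) - f x - (\<Sum>i\<in>UNIV. v $ i * partial_deriv i f x)
      - (\<Sum>i\<in>UNIV. v $ i * (\<Sum>j\<in>UNIV. v $ j * partial_derivs [j, i] f x)) / 2\<bar>
    \<le> real (CARD('n)) ^ 3 * B / 6 * r ^ 3"
proof -
  \<comment> \<open>\<open>d m\<close> is the \<open>m\<close>-th derivative of \<open>\<lambda>t. f (x + t *\<^sub>R v)\<close>.\<close>
  define d where "d = (\<lambda>m t. [f (x + t *\<^sub>R v),
     (\<Sum>i\<in>UNIV. v $ i * partial_derivs [i] f (x + t *\<^sub>R v)),
     (\<Sum>i\<in>UNIV. v $ i * (\<Sum>j\<in>UNIV. v $ j * partial_derivs [j, i] f (x + t *\<^sub>R v))),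
     (\<Sum>i\<in>UNIV. v $ i * (\<Sum>j\<in>UNIV. v $ j *
        (\<Sum>k\<in>UNIV. v $ k * partial_derivs [k, j, i] f (x + t *\<^sub>R v))))] ! m)"
  have der: "(d m has_real_derivative d (Suc m) t) (at t)"
    if "m < 3" "0 \<le> t" "t \<le> 1" for m t
  proof -
    note L = partial_derivs_along_line[OF S seg[OF that(2,3)]]
    from that(1) have "m = 0 \<or> m = 1 \<or> m = 2"
      by linarith
    then consider "m = 0" | "m = 1" | "m = 2"
      by blast
    then show ?thesis
    proof cases
      case 1
      then show ?thesis
        using L[of "[]"] by (simp add: d_def)
    next
      case 2
      then show ?thesis
        using DERIV_sum[OF DERIV_cmult[OF L]] by (simp add: d_def del: partial_derivs.simps)
    next
      case 3
      then show ?thesis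
        using DERIV_sum[OF DERIV_cmult[OF DERIV_sum[OF DERIV_cmult[OF L]]]]
        by (simp add: d_def eval_nat_numeral del: partial_derivs.simps)
    qed
  qed
  obtain t where t: "0 < t" "t < 1"
    and T: "d 0 1 = (\<Sum>m<3. d m 0 / fact m * 1 ^ m) + d 3 t / fact 3 * 1 ^ 3"
    using Maclaurin[of 1 3 d "d 0"] der by auto
  have r0: "0 \<le> r"
    using r by (meson abs_ge_zero order_trans)
  have mem: "x + t *\<^sub>R v \<in> S"
    using seg t by simp
  have bnd: "\<bar>\<Sum>i\<in>UNIV. v $ i * g i\<bar> \<le> real (CARD('n)) * r * b"
    if "\<And>i. \<bar>g i\<bar> \<le> b" for g :: "'n \<Rightarrow> real" and b
  proof -
    have "\<bar>v $ i * g i\<bar> \<le> r * b" for i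
      unfolding abs_mult using r that r0 by (intro mult_mono) auto
    then have "\<bar>\<Sum>i\<in>UNIV. v $ i * g i\<bar> \<le> of_nat (CARD('n)) * (r * b)"
      by (intro order_trans[OF sum_abs] sum_bounded_above) auto
    then show ?thesis
      by (simp add: mult_ac)
  qed
  have "\<bar>d 3 t\<bar> \<le> real (CARD('n)) * r * (real (CARD('n)) * r * (real (CARD('n)) * r * B))"
    unfolding d_def by (simp del: partial_derivs.simps) (intro bnd B mem)
  also have "\<dots> = real (CARD('n)) ^ 3 * B * r ^ 3"
    by (simp add: power3_eq_cube)
  finally have "\<bar>d 3 t / 6\<bar> \<le> real (CARD('n)) ^ 3 * B / 6 * r ^ 3"
    by simp
  moreover have "d 3 t / 6 = f (x + v) - f x - (\<Sum>i\<in>UNIV. v $ i * partial_deriv i f x)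
      - (\<Sum>i\<in>UNIV. v $ i * (\<Sum>j\<in>UNIV. v $ j * partial_derivs [j, i] f x)) / 2"
  proof -
    have "d 0 1 = d 0 0 + d 1 0 + d 2 0 / 2 + d 3 t / 6"
      using T by (simp add: eval_nat_numeral)
    moreover have "d 0 1 = f (x + v)" "d 0 0 = f x"
      "d 1 0 = (\<Sum>i\<in>UNIV. v $ i * partial_deriv i f x)"
      "d 2 0 = (\<Sum>i\<in>UNIV. v $ i * (\<Sum>j\<in>UNIV. v $ j * partial_derivs [j, i] f x))"
      by (simp_all add: d_def)
    ultimately show ?thesis
      by linarith
  qed
  ultimately show ?thesis
    by simp
qed

section \<open>The game Laplacian for exponent four\<close>

lemma norm_gradient_power2: "(norm (gradient f x))\<^sup>2 = (\<Sum>i\<in>UNIV. (partial_deriv i f x)\<^sup>2)"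
  by (simp add: gradient_def norm_vec_def L2_set_def sum_nonneg)

text \<open>
  For \<open>p = 4\<close> the weight \<open>|\<nabla>f|\<^sup>2\<close> in the divergence is polynomial in the partial derivatives, so the
  product rule applies directly. Both sides carry a factor \<open>|\<nabla>f|\<^sup>2\<close> to avoid the quotient.
\<close>

lemma game_laplacian_4:
  fixes f :: "real ^ 'n \<Rightarrow> real"
  assumes S: "open S" "f \<in> Cb_infinity S" "x \<in> S" and nz: "gradient f x \<noteq> 0"
  shows "game_laplacian 4 f x * (norm (gradient f x))\<^sup>2 =
    (norm (gradient f x))\<^sup>2 * (\<Sum>i\<in>UNIV. partial_derivs [i, i] f x) / 4
    + (\<Sum>i\<in>UNIV. partial_deriv i f x *
        (\<Sum>j\<in>UNIV. partial_deriv j f x * partial_derivs [i, j] f x)) / 2"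
proof -
  let ?g = "gradient f"
  have D: "partial_deriv i (\<lambda>y. (norm (?g y))\<^sup>2 * ?g y $ i) x =
      2 * (\<Sum>k\<in>UNIV. partial_derivs [k] f x * partial_derivs [i, k] f x) * partial_derivs [i] f x
      + (norm (?g x))\<^sup>2 * partial_derivs [i, i] f x" for i
  proof -
    have eq: "(\<lambda>y. (norm (?g y))\<^sup>2 * ?g y $ i)
      = (\<lambda>y. (\<Sum>k\<in>UNIV. (partial_derivs [k] f y)\<^sup>2) * partial_derivs [i] f y)"
      by (simp add: norm_gradient_power2) (simp add: gradient_def)
    note H = partial_derivs_has_derivative[OF S]
    have "((\<lambda>y. (\<Sum>k\<in>UNIV. (partial_derivs [k] f y)\<^sup>2) * partial_derivs [i] f y) has_derivative
      (\<lambda>v. (\<Sum>k\<in>UNIV. (partial_derivs [k] f x)\<^sup>2) * (\<Sum>j\<in>UNIV. v $ j * partial_derivs [j, i] f x)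
        + (\<Sum>k\<in>UNIV. 2 * partial_derivs [k] f x * (\<Sum>j\<in>UNIV. v $ j * partial_derivs [j, k] f x))
          * partial_derivs [i] f x)) (at x)"
      by (rule derivative_eq_intros H refl)+ (simp add: fun_eq_iff mult_ac del: partial_derivs.simps)
    from frechet_derivative_at[OF this, symmetric] show ?thesis
      unfolding partial_deriv_def eq
      by (simp add: axis_def if_distrib[of "\<lambda>c. c * _"] cong: if_cong)
        (simp add: norm_gradient_power2 sum_distrib_left mult_ac)
  qed
  have n0: "norm (?g x) > 0"
    using nz by simp
  then have "norm (?g x) powr (2 - 4) = 1 / (norm (?g x))\<^sup>2"
    by (simp add: powr_minus_divide)
  then show ?thesis
    using n0 unfolding game_laplacian_def divergence_def 
    by (simp add: D) (simp add: sum.distrib sum_distrib_left mult_ac field_simps)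
qed

section \<open>Moments of the hexagon\<close>

lemma sum_hexagon: "(\<Sum>j = 0..5. h (hexagon_vertex 1 j)) =
    h (vector [1, 0]) + h (vector [1/2, sqrt 3/2]) + h (vector [-1/2, sqrt 3/2])
    + h (vector [-1, 0]) + h (vector [-1/2, - sqrt 3/2]) + h (vector [1/2, - sqrt 3/2])"
  for h :: "real ^ 2 \<Rightarrow> real"
proof -
  have e: "hexagon_vertex 1 0 = vector [1, 0]"
    "hexagon_vertex 1 1 = vector [1/2, sqrt 3/2]"
    "hexagon_vertex 1 2 = vector [-1/2, sqrt 3/2]"
    "hexagon_vertex 1 3 = vector [-1, 0]"
    by (simp_all add: hexagon_vertex_def cos_60 sin_60 cos_120 sin_120)
  have 4: "2 * pi * real 4 / 6 = pi / 3 + pi" and 5: "2 * pi * real 5 / 6 = - (pi / 3) + 2 * pi"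
    by simp_all
  have e4: "hexagon_vertex 1 4 = vector [-1/2, - sqrt 3/2]"
    unfolding hexagon_vertex_def 4 cos_periodic_pi sin_periodic_pi by (simp add: cos_60 sin_60)
  have e5: "hexagon_vertex 1 5 = vector [1/2, - sqrt 3/2]"
    unfolding hexagon_vertex_def 5 cos_periodic sin_periodic by (simp add: cos_60 sin_60)
  have "{0..5::nat} = {0,1,2,3,4,5}"
    by auto
  then show ?thesis
    by (simp add: e[simplified] e4 e5)
qed

lemma sqrt_3_mult_self: "sqrt 3 * (sqrt 3 * z) = 3 * z"
  by (simp flip: mult.assoc)

lemma hexagon_moment_3:
  "(\<Sum>j = 0..5. (\<Sum>i\<in>UNIV. hexagon_vertex 1 j $ i * g i) ^ 3) = 0"
  by (subst sum_hexagon) (simp add: sum_2 field_simps power3_eq_cube sqrt_3_mult_self)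

lemma hexagon_moment_2:
  "(\<Sum>j = 0..5. (\<Sum>i\<in>UNIV. hexagon_vertex 1 j $ i * g i)\<^sup>2) = 3 * (\<Sum>i\<in>UNIV. (g i)\<^sup>2)"
  by (subst sum_hexagon) (simp add: sum_2 field_simps power2_eq_square sqrt_3_mult_self)

text \<open>
  The average of \<open>e\<^sub>a e\<^sub>b e\<^sub>c e\<^sub>d\<close> over the six vertices is isotropic, namely one eighth of the sum of
  the three products of Kronecker deltas that pair off the indices. Contracting with \<open>g\<close>, \<open>g\<close> and
  \<open>H\<close> gives a trace and twice the quadratic form of \<open>H\<close> at \<open>g\<close>; the factor is \<open>6/8\<close>.
\<close>

lemma hexagon_moment_4:
  "(\<Sum>j = 0..5. (\<Sum>i\<in>UNIV. hexagon_vertex 1 j $ i * g i)\<^sup>2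
      * (\<Sum>i\<in>UNIV. hexagon_vertex 1 j $ i * (\<Sum>k\<in>UNIV. hexagon_vertex 1 j $ k * H k i)))
   = 3 / 4 * ((\<Sum>i\<in>UNIV. (g i)\<^sup>2) * (\<Sum>i\<in>UNIV. H i i)
      + 2 * (\<Sum>i\<in>UNIV. g i * (\<Sum>k\<in>UNIV. g k * H i k)))"
  by (subst sum_hexagon) (simp add: sum_2 field_simps power2_eq_square sqrt_3_mult_self)

section \<open>Quartic averages\<close>

text \<open>
  The graph of the fourth power lies strictly above each tangent away from the point of contact.
  Summed over the data, this makes a zero of the derivative a strict global minimizer, which gives
  existence and uniqueness at once.
\<close>

lemma quartic_tangent_less:
  fixes u h :: real
  assumes "h \<noteq> 0"
  shows "u ^ 4 - 4 * u ^ 3 * h < (u - h) ^ 4"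
proof -
  have "(u - h) ^ 4 - u ^ 4 + 4 * u ^ 3 * h = h\<^sup>2 * ((2 * u - h)\<^sup>2 + 2 * u\<^sup>2)"
    by algebra
  moreover have "(2 * u - h)\<^sup>2 + 2 * u\<^sup>2 > 0"
    using assms by (cases "u = 0") (auto intro: add_nonneg_pos)
  ultimately show ?thesis
    using assms by (smt (verit) zero_less_mult_iff zero_less_power2)
qed

lemma sum_cubes_root_exists:
  fixes b :: "'i \<Rightarrow> real"
  assumes "finite J"
  obtains c where "(\<Sum>j\<in>J. (b j - c) ^ 3) = 0"
proof -
  define M where "M = (\<Sum>j\<in>J. \<bar>b j\<bar>)"
  have M: "\<bar>b j\<bar> \<le> M" if "j \<in> J" for j
    unfolding M_def using assms that by (intro member_le_sum) auto
  have "M \<ge> 0"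
    unfolding M_def by (simp add: sum_nonneg)
  have lo: "(\<Sum>j\<in>J. (b j - M) ^ 3) \<le> 0"
    using M by (intro sum_nonpos) (force simp: power_le_zero_eq)
  have hi: "0 \<le> (\<Sum>j\<in>J. (b j - - M) ^ 3)"
    using M by (intro sum_nonneg) (force simp: abs_le_iff)
  have "\<exists>c\<ge>- M. c \<le> M \<and> (\<Sum>j\<in>J. (b j - c) ^ 3) = 0"
    using lo hi \<open>M \<ge> 0\<close> by (intro IVT2') (auto intro!: continuous_intros)
  then show ?thesis
    using that by blast
qed

lemma quartic_average_root:
  fixes b :: "'i \<Rightarrow> real"
  assumes J: "finite J" "J \<noteq> {}"
  shows "(\<Sum>j\<in>J. (b j - (THE c. is_arg_min (\<lambda>c. \<Sum>j\<in>J. \<bar>b j - c\<bar> ^ 4) (\<lambda>_. True) c)) ^ 3) = 0"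
proof -
  let ?F = "\<lambda>c. \<Sum>j\<in>J. \<bar>b j - c\<bar> ^ 4"
  obtain c where c: "(\<Sum>j\<in>J. (b j - c) ^ 3) = 0"
    using sum_cubes_root_exists[OF J(1)] .
  have less: "?F c < ?F d" if "d \<noteq> c" for d
  proof -
    have "(b j - c) ^ 4 - 4 * (b j - c) ^ 3 * (d - c) < (b j - d) ^ 4" for j
      using quartic_tangent_less[of "d - c" "b j - c"] that by simp
    then have "(\<Sum>j\<in>J. (b j - c) ^ 4 - 4 * (b j - c) ^ 3 * (d - c)) < (\<Sum>j\<in>J. (b j - d) ^ 4)"
      using J by (intro sum_strict_mono) auto
    moreover have "(\<Sum>j\<in>J. (b j - c) ^ 4 - 4 * (b j - c) ^ 3 * (d - c)) = (\<Sum>j\<in>J. (b j - c) ^ 4)"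
      using c by (simp add: sum_subtractf flip: sum_distrib_left sum_distrib_right)
    ultimately show ?thesis
      by simp
  qed
  have "(THE c. is_arg_min ?F (\<lambda>_. True) c) = c"
  proof (rule the_equality)
    show "is_arg_min ?F (\<lambda>_. True) c"
      unfolding is_arg_min_def using less by (metis less_asym)
    show "d = c" if "is_arg_min ?F (\<lambda>_. True) d" for d
      using that less unfolding is_arg_min_def by blast
  qed
  with c show ?thesis
    by simp
qed

text \<open>
  A trial value \<open>t0\<close> is close to the root \<open>t\<close> once the sum of cubes is small there, provided
  that the sum of squares is not: a difference of cubes factors as
  \<open>u\<^sup>3 - w\<^sup>3 = (u - w) (u\<^sup>2 + u w + w\<^sup>2)\<close>, and the quadratic factor is at least \<open>3/4 u\<^sup>2\<close>.
\<close>

lemma sum_cubes_root_distance: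
  fixes b :: "'i \<Rightarrow> real"
  assumes "(\<Sum>j\<in>J. (b j - t) ^ 3) = 0"
  shows "\<bar>t - t0\<bar> * (3 / 4 * (\<Sum>j\<in>J. (b j - t0)\<^sup>2)) \<le> \<bar>\<Sum>j\<in>J. (b j - t0) ^ 3\<bar>"
proof -
  define k where "k j = (b j - t0)\<^sup>2 + (b j - t0) * (b j - t) + (b j - t)\<^sup>2" for j
  have k: "3 / 4 * (b j - t0)\<^sup>2 \<le> k j" for j
  proof -
    have "k j - 3 / 4 * (b j - t0)\<^sup>2 = ((b j - t0) / 2 + (b j - t))\<^sup>2"
      unfolding k_def by (simp add: power2_eq_square field_simps)
    then show ?thesis
      by (smt (verit) zero_le_power2)
  qed
  have "(\<Sum>j\<in>J. (b j - t0) ^ 3) = (\<Sum>j\<in>J. (b j - t0) ^ 3 - (b j - t) ^ 3)"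
    using assms by (simp add: sum_subtractf)
  also have "\<dots> = (\<Sum>j\<in>J. (t - t0) * k j)"
  proof (rule sum.cong)
    show "(b j - t0) ^ 3 - (b j - t) ^ 3 = (t - t0) * k j" for j
      unfolding k_def by algebra
  qed simp
  also have "\<dots> = (t - t0) * (\<Sum>j\<in>J. k j)"
    by (simp add: sum_distrib_left)
  finally have eq: "\<bar>\<Sum>j\<in>J. (b j - t0) ^ 3\<bar> = \<bar>t - t0\<bar> * \<bar>\<Sum>j\<in>J. k j\<bar>"
    by (simp add: abs_mult)
  have "3 / 4 * (\<Sum>j\<in>J. (b j - t0)\<^sup>2) \<le> \<bar>\<Sum>j\<in>J. k j\<bar>"
    unfolding sum_distrib_left by (rule order_trans[OF sum_mono[OF k] abs_ge_self])
  then show ?thesis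
    unfolding eq by (rule mult_left_mono) simp
qed

text \<open>
  Lemma \<open>sum_cubes_root_distance\<close> is applied with \<open>t0 = \<epsilon>\<^sup>2 * s\<close>. The choice of \<open>s\<close> and the vanishing
  third moment remove the terms of order \<open>\<epsilon>\<^sup>3\<close> and \<open>\<epsilon>\<^sup>4\<close> from the sum of cubes, which is therefore of order
  \<open>\<epsilon>\<^sup>5\<close>, whereas the sum of squares is at least \<open>\<epsilon>\<^sup>2 * \<mu> / 4\<close>. The constant is explicit, so that
  it is visibly independent of the data apart from their bounds.
\<close>

lemma sum_cubes_root_expansion:
  fixes L Q C P \<mu> \<epsilon> n :: real and l q a :: "'i \<Rightarrow> real" and J :: "'i set"
  assumes P_def: "P = 2 * Q + C" and n_def: "n = real (card J)"
    and l: "\<And>j. j \<in> J \<Longrightarrow> \<bar>l j\<bar> \<le> L" and q: "\<And>j. j \<in> J \<Longrightarrow> \<bar>q j\<bar> \<le> Q"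
    and a: "\<And>j. j \<in> J \<Longrightarrow> \<bar>a j - \<epsilon> * l j - \<epsilon>\<^sup>2 * q j\<bar> \<le> C * \<epsilon> ^ 3"
    and nonneg: "0 \<le> L" "0 \<le> Q" "0 \<le> C"
    and l3: "(\<Sum>j\<in>J. l j ^ 3) = 0"
    and \<mu>: "0 < \<mu>" and l2: "\<mu> \<le> (\<Sum>j\<in>J. (l j)\<^sup>2)"
    and s: "s * (\<Sum>j\<in>J. (l j)\<^sup>2) = (\<Sum>j\<in>J. (l j)\<^sup>2 * q j)"
    and t: "(\<Sum>j\<in>J. (a j - t) ^ 3) = 0"
    and \<epsilon>: "0 < \<epsilon>" "\<epsilon> \<le> 1" "\<epsilon> * (n * P\<^sup>2) \<le> \<mu> / 4"
  shows "\<bar>t - \<epsilon>\<^sup>2 * s\<bar> \<le> 16 * (n * (3 * L\<^sup>2 * C + 3 * L * P\<^sup>2 + P ^ 3)) / (3 * \<mu>) * \<epsilon> ^ 3"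
proof -
  define M where "M = n * (3 * L\<^sup>2 * C + 3 * L * P\<^sup>2 + P ^ 3)"
  have n0: "0 \<le> n" and P0: "0 \<le> P"
    using nonneg by (auto simp: n_def P_def)
  have sQ: "\<bar>s\<bar> \<le> Q"
  proof -
    have "\<bar>s\<bar> * (\<Sum>j\<in>J. (l j)\<^sup>2) = \<bar>\<Sum>j\<in>J. (l j)\<^sup>2 * q j\<bar>"
      unfolding s[symmetric] by (simp add: abs_mult sum_nonneg)
    also have "\<dots> \<le> (\<Sum>j\<in>J. (l j)\<^sup>2 * Q)"
      using q by (intro order_trans[OF sum_abs] sum_mono) (simp add: abs_mult mult_left_mono)
    also have "\<dots> = Q * (\<Sum>j\<in>J. (l j)\<^sup>2)"
      by (simp add: sum_distrib_left mult.commute)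
    finally show ?thesis
      using l2 \<mu> by simp
  qed
  \<comment> \<open>After the shift by \<open>\<epsilon>\<^sup>2 * s\<close> the data are \<open>\<epsilon> * l j + \<epsilon>\<^sup>2 * p j\<close>, where \<open>p j\<close> is bounded by \<open>P\<close>
    and differs from \<open>q j - s\<close> by the scaled Taylor remainder \<open>r j\<close> of order \<open>\<epsilon>\<close>.\<close>
  define r where "r j = (a j - \<epsilon> * l j - \<epsilon>\<^sup>2 * q j) / \<epsilon>\<^sup>2" for j
  define p where "p j = q j - s + r j" for j
  have r: "\<bar>r j\<bar> \<le> C * \<epsilon>" if "j \<in> J" for j
    using a[OF that] \<epsilon> by (simp add: r_def field_simps power3_eq_cube power2_eq_square)
  have p: "\<bar>p j\<bar> \<le> P" if "j \<in> J" for j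
  proof -
    have "C * \<epsilon> \<le> C"
      using \<epsilon> nonneg by (simp add: mult_left_le)
    then show ?thesis
      using r[OF that] q[OF that] sQ unfolding p_def P_def by linarith
  qed
  have ap: "a j - \<epsilon>\<^sup>2 * s = \<epsilon> * l j + \<epsilon>\<^sup>2 * p j" for j
    using \<epsilon> by (simp add: p_def r_def field_simps)
  have up: "\<bar>\<Sum>j\<in>J. (a j - \<epsilon>\<^sup>2 * s) ^ 3\<bar> \<le> M * \<epsilon> ^ 5"
  proof -
    have "(\<Sum>j\<in>J. (l j)\<^sup>2 * (q j - s)) = (\<Sum>j\<in>J. (l j)\<^sup>2 * q j) - s * (\<Sum>j\<in>J. (l j)\<^sup>2)"
      by (simp add: right_diff_distrib sum_subtractf sum_distrib_left mult.commute[of s])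
    then have "(\<Sum>j\<in>J. (a j - \<epsilon>\<^sup>2 * s) ^ 3) = (\<Sum>j\<in>J. (a j - \<epsilon>\<^sup>2 * s) ^ 3)
        - \<epsilon> ^ 3 * (\<Sum>j\<in>J. l j ^ 3) - 3 * \<epsilon> ^ 4 * (\<Sum>j\<in>J. (l j)\<^sup>2 * (q j - s))"
      by (simp add: l3 s)
    also have "\<dots> = (\<Sum>j\<in>J. (a j - \<epsilon>\<^sup>2 * s) ^ 3 - \<epsilon> ^ 3 * l j ^ 3
        - 3 * \<epsilon> ^ 4 * ((l j)\<^sup>2 * (q j - s)))"
      by (simp add: sum_subtractf sum_distrib_left)
    also have "\<bar>\<dots>\<bar> \<le> n * ((3 * L\<^sup>2 * C + 3 * L * P\<^sup>2 + P ^ 3) * \<epsilon> ^ 5)"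
      unfolding n_def
    proof (intro order_trans[OF sum_abs] sum_bounded_above)
      fix j assume j: "j \<in> J"
      have "(a j - \<epsilon>\<^sup>2 * s) ^ 3 - \<epsilon> ^ 3 * l j ^ 3 - 3 * \<epsilon> ^ 4 * ((l j)\<^sup>2 * (q j - s))
        = \<epsilon> ^ 4 * (3 * (l j)\<^sup>2 * r j) + \<epsilon> ^ 5 * (3 * l j * (p j)\<^sup>2) + \<epsilon> ^ 5 * (\<epsilon> * p j ^ 3)"
        unfolding ap p_def by algebra
      moreover have "\<bar>\<epsilon> ^ 4 * (3 * (l j)\<^sup>2 * r j)\<bar> \<le> \<epsilon> ^ 4 * (3 * L\<^sup>2 * (C * \<epsilon>))"
        unfolding abs_mult power_abs abs_power2
        using l[OF j] r[OF j] \<epsilon> nonneg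
        by (intro mult_mono) (auto intro: abs_le_square_iff[THEN iffD1])
      moreover have "\<bar>\<epsilon> ^ 5 * (3 * l j * (p j)\<^sup>2)\<bar> \<le> \<epsilon> ^ 5 * (3 * L * P\<^sup>2)"
        unfolding abs_mult power_abs
        using l[OF j] p[OF j] \<epsilon> nonneg P0
        by (intro mult_mono power_mono) auto
      moreover have "\<bar>\<epsilon> ^ 5 * (\<epsilon> * p j ^ 3)\<bar> \<le> \<epsilon> ^ 5 * (1 * P ^ 3)"
        unfolding abs_mult power_abs
        using p[OF j] \<epsilon> P0 by (intro mult_mono power_mono) auto
      moreover have "\<epsilon> ^ 4 * (3 * L\<^sup>2 * (C * \<epsilon>)) + \<epsilon> ^ 5 * (3 * L * P\<^sup>2) + \<epsilon> ^ 5 * (1 * P ^ 3)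
        = (3 * L\<^sup>2 * C + 3 * L * P\<^sup>2 + P ^ 3) * \<epsilon> ^ 5"
        by algebra
      ultimately show "\<bar>(a j - \<epsilon>\<^sup>2 * s) ^ 3 - \<epsilon> ^ 3 * l j ^ 3 - 3 * \<epsilon> ^ 4 * ((l j)\<^sup>2 * (q j - s))\<bar>
        \<le> (3 * L\<^sup>2 * C + 3 * L * P\<^sup>2 + P ^ 3) * \<epsilon> ^ 5"
        by linarith
    qed
    finally show ?thesis
      by (simp add: M_def mult_ac)
  qed
  have low: "\<epsilon>\<^sup>2 * (\<mu> / 4) \<le> (\<Sum>j\<in>J. (a j - \<epsilon>\<^sup>2 * s)\<^sup>2)"
  proof -
    \<comment> \<open>From \<open>(u + v)\<^sup>2 \<ge> u\<^sup>2 / 2 - v\<^sup>2\<close>.\<close>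
    have sq: "\<epsilon>\<^sup>2 * ((l j)\<^sup>2 / 2 - \<epsilon>\<^sup>2 * P\<^sup>2) \<le> (a j - \<epsilon>\<^sup>2 * s)\<^sup>2" if "j \<in> J" for j
    proof -
      have "(l j + \<epsilon> * p j)\<^sup>2 - ((l j)\<^sup>2 / 2 - \<epsilon>\<^sup>2 * (p j)\<^sup>2) = (l j + 2 * \<epsilon> * p j)\<^sup>2 / 2"
        by (simp add: power2_eq_square field_simps)
      then have "(l j)\<^sup>2 / 2 - \<epsilon>\<^sup>2 * (p j)\<^sup>2 \<le> (l j + \<epsilon> * p j)\<^sup>2"
        by (smt (verit) zero_le_power2 divide_nonneg_pos)
      moreover have "(p j)\<^sup>2 \<le> P\<^sup>2"
        using power_mono[OF p[OF that] abs_ge_zero, of 2] by simp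
      then have "\<epsilon>\<^sup>2 * (p j)\<^sup>2 \<le> \<epsilon>\<^sup>2 * P\<^sup>2"
        by (simp add: mult_left_mono)
      ultimately have "\<epsilon>\<^sup>2 * ((l j)\<^sup>2 / 2 - \<epsilon>\<^sup>2 * P\<^sup>2) \<le> \<epsilon>\<^sup>2 * (l j + \<epsilon> * p j)\<^sup>2"
        by (intro mult_left_mono) auto
      then show ?thesis
        unfolding ap by (simp add: power2_eq_square field_simps)
    qed
    have "\<epsilon>\<^sup>2 * (n * P\<^sup>2) \<le> \<epsilon> * (n * P\<^sup>2)"
      using \<epsilon> n0 by (intro mult_right_mono) (auto simp: power2_eq_square mult_left_le)
    with \<epsilon>(3) have "\<epsilon>\<^sup>2 * (\<mu> / 4) \<le> \<epsilon>\<^sup>2 * ((\<Sum>j\<in>J. (l j)\<^sup>2) / 2 - \<epsilon>\<^sup>2 * (n * P\<^sup>2))"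
      using l2 by (intro mult_left_mono) auto
    also have "\<dots> = (\<Sum>j\<in>J. \<epsilon>\<^sup>2 * ((l j)\<^sup>2 / 2 - \<epsilon>\<^sup>2 * P\<^sup>2))"
      by (simp add: sum_subtractf n_def right_diff_distrib sum_divide_distrib sum_distrib_left)
    also have "\<dots> \<le> (\<Sum>j\<in>J. (a j - \<epsilon>\<^sup>2 * s)\<^sup>2)"
      by (rule sum_mono[OF sq])
    finally show ?thesis .
  qed
  have "\<bar>t - \<epsilon>\<^sup>2 * s\<bar> * (3 / 4 * (\<epsilon>\<^sup>2 * (\<mu> / 4)))
      \<le> \<bar>t - \<epsilon>\<^sup>2 * s\<bar> * (3 / 4 * (\<Sum>j\<in>J. (a j - \<epsilon>\<^sup>2 * s)\<^sup>2))"
    using low by (intro mult_left_mono) auto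
  also have "\<dots> \<le> M * \<epsilon> ^ 5"
    using sum_cubes_root_distance[OF t] up by (rule order_trans)
  also have "\<dots> = (16 * M / (3 * \<mu>) * \<epsilon> ^ 3) * (3 / 4 * (\<epsilon>\<^sup>2 * (\<mu> / 4)))"
    using \<mu> by (simp add: field_simps eval_nat_numeral)
  finally show ?thesis
    using \<epsilon> \<mu> unfolding M_def by (simp only: mult_le_cancel_right) (simp add: zero_less_mult_iff)
qed

section \<open>The asymptotic mean value property\<close>

lemma open_unit_enlargement: "open (unit_enlargement S)"
  unfolding unit_enlargement_def
  by (intro open_Collect_less continuous_intros)

lemma closure_subset_unit_enlargement:
  assumes "S \<noteq> {}"
  shows "closure S \<subseteq> unit_enlargement S"
  by (auto simp: unit_enlargement_def in_closure_iff_infdist_zero[OF assms])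

lemma gradient_bounded_below:
  fixes f :: "real ^ 'n \<Rightarrow> real"
  assumes "open S" "f \<in> Cb_infinity S" "compact K" "K \<noteq> {}" "K \<subseteq> S" "\<And>x. x \<in> K \<Longrightarrow> gradient f x \<noteq> 0"
  obtains m where "0 < m" "\<And>x. x \<in> K \<Longrightarrow> m \<le> norm (gradient f x)"
proof -
  have "continuous_on S (partial_derivs is f)" for "is"
    using assms(2) by (auto simp: Cb_infinity_def intro: differentiable_imp_continuous_on)
  from this[of "[_]"] have "continuous_on K (gradient f)"
    unfolding gradient_def using assms(5)
    by (auto intro!: continuous_on_vec_lambda intro: continuous_on_subset)
  then have "continuous_on K (\<lambda>x. norm (gradient f x))"
    by (intro continuous_intros)
  from continuous_attains_inf[OF assms(3,4) this] obtain x
    where "x \<in> K" "\<forall>y\<in>K. norm (gradient f x) \<le> norm (gradient f y)"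
    by blast
  then show ?thesis
    using that[of "norm (gradient f x)"] assms(6) by auto
qed

lemma partial_derivs_uniformly_bounded:
  fixes f :: "real ^ 'n \<Rightarrow> real"
  assumes "f \<in> Cb_infinity S"
  obtains B where "0 \<le> B" "\<And>is x. length is \<le> n \<Longrightarrow> x \<in> S \<Longrightarrow> \<bar>partial_derivs is f x\<bar> \<le> B"
proof -
  have "finite {is :: 'n list. length is \<le> n}"
    using finite_lists_length_le[of "UNIV :: 'n set" n] by simp
  then have "bounded (\<Union>is\<in>{is. length is \<le> n}. partial_derivs is f ` S)"
    using assms by (intro bounded_UN) (auto simp: Cb_infinity_def)
  then obtain B where "B > 0" "\<forall>y\<in>(\<Union>is\<in>{is. length is \<le> n}. partial_derivs is f ` S). norm y \<le> B"
    unfolding bounded_pos by blast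
  then show ?thesis
    by (intro that[of B]) auto
qed

lemma hexagon_vertex_scale: "hexagon_vertex \<epsilon> j = \<epsilon> *\<^sub>R hexagon_vertex 1 j"
  by (simp add: hexagon_vertex_def)

lemma norm_hexagon_vertex: "norm (hexagon_vertex 1 j) = 1"
  by (simp add: hexagon_vertex_def norm_vec_def L2_set_def sum_2)

theorem theorem3p3:
  fixes \<Omega> :: "(real ^ 2) set" and \<phi> :: "real ^ 2 \<Rightarrow> real"
  assumes "open \<Omega>" and "connected \<Omega>" and "\<Omega> \<noteq> {}" and "bounded \<Omega>"
    and "\<phi> \<in> Cb_infinity (unit_enlargement \<Omega>)"
    and "\<forall>x\<in>unit_enlargement \<Omega>. gradient \<phi> x \<noteq> 0"
  shows "uniform_limit \<Omega>
    (\<lambda>\<epsilon> x. (\<phi> x - (hexagon_average4 \<epsilon> \<phi> x + 1 / 2 * \<epsilon>\<^sup>2 * (- game_laplacian 4 \<phi> x))) / \<epsilon>\<^sup>2)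
    (\<lambda>x. 0) (at_right 0)"
proof -
  let ?E = "unit_enlargement \<Omega>"
  let ?e = "hexagon_vertex 1"
  define l where "l x j = (\<Sum>i\<in>UNIV. ?e j $ i * partial_deriv i \<phi> x)" for x j
  define q where "q x j = (\<Sum>i\<in>UNIV. ?e j $ i * (\<Sum>k\<in>UNIV. ?e j $ k * partial_derivs [k, i] \<phi> x)) / 2"
    for x j
  note E = open_unit_enlargement[of \<Omega>] assms(5)
  have cl: "closure \<Omega> \<subseteq> ?E"
    by (rule closure_subset_unit_enlargement[OF assms(3)])
  have sub: "x \<in> ?E" if "x \<in> \<Omega>" for x
    using cl closure_subset that by blast
  have e: "\<bar>?e j $ i\<bar> \<le> 1" for i j
    using component_le_norm_cart[of "?e j" i] by (simp add: norm_hexagon_vertex)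
  obtain m where m: "0 < m" "\<And>x. x \<in> closure \<Omega> \<Longrightarrow> m \<le> norm (gradient \<phi> x)"
    using gradient_bounded_below[OF E, of "closure \<Omega>"] assms cl by (auto simp: compact_closure)
  obtain B where B0: "0 \<le> B"
    and B: "\<And>is x. length is \<le> 3 \<Longrightarrow> x \<in> ?E \<Longrightarrow> \<bar>partial_derivs is \<phi> x\<bar> \<le> B"
    using partial_derivs_uniformly_bounded[OF assms(5), of 3] by metis
  have bnd: "\<bar>\<Sum>i\<in>UNIV. ?e j $ i * g i\<bar> \<le> 2 * b" if "\<And>i. \<bar>g i\<bar> \<le> b" for g b j
  proof -
    have "\<bar>?e j $ i * g i\<bar> \<le> 1 * b" for i
      unfolding abs_mult using e that by (intro mult_mono) auto
    then show ?thesis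
      using sum_bounded_above[of "UNIV :: 2 set" "\<lambda>i. \<bar>?e j $ i * g i\<bar>" b]
      by (intro order_trans[OF sum_abs]) auto
  qed
  \<comment> \<open>The constants of \<open>sum_cubes_root_expansion\<close> for six vertices, \<open>L = Q = 2 * B\<close>,
    \<open>C = 4 * B / 3\<close> (the Taylor remainder \<open>2 ^ 3 * B / 6\<close>) and \<open>\<mu> = 3 * m\<^sup>2\<close>.\<close>
  define P where "P = 2 * (2 * B) + 4 * B / 3"
  define K where "K = 16 * (6 * (3 * (2 * B)\<^sup>2 * (4 * B / 3) + 3 * (2 * B) * P\<^sup>2 + P ^ 3)) / (3 * (3 * m\<^sup>2))"
  define \<epsilon>0 where "\<epsilon>0 = min 1 (3 * m\<^sup>2 / 4 / (6 * P\<^sup>2 + 1))"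
  have pos: "0 < 6 * P\<^sup>2 + 1"
    by (simp add: add_nonneg_pos)
  have \<epsilon>0: "0 < \<epsilon>0" "\<epsilon>0 \<le> 1"
    using m pos by (auto simp: \<epsilon>0_def)
  have main: "\<bar>(hexagon_average4 \<epsilon> \<phi> x - \<phi> x) - \<epsilon>\<^sup>2 * (game_laplacian 4 \<phi> x / 2)\<bar> \<le> K * \<epsilon> ^ 3"
    if \<epsilon>: "0 < \<epsilon>" "\<epsilon> < \<epsilon>0" and x: "x \<in> \<Omega>" for \<epsilon> x
    unfolding K_def
  proof (rule sum_cubes_root_expansion[where J = "{0..5::nat}" and Q = "2 * B"
        and l = "l x" and q = "q x" and a = "\<lambda>j. \<phi> (x + hexagon_vertex \<epsilon> j) - \<phi> x"])
    note xE = sub[OF x]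
    show "P = 2 * (2 * B) + 4 * B / 3" "6 = real (card {0..5::nat})" "0 < \<epsilon>"
      by (simp_all add: P_def \<epsilon>)
    show "\<epsilon> \<le> 1"
      using \<epsilon> \<epsilon>0 by simp
    show "0 \<le> 2 * B" "0 \<le> 2 * B" "0 \<le> 4 * B / 3" "0 < 3 * m\<^sup>2"
      using B0 m by auto
    have "\<epsilon> * (6 * P\<^sup>2 + 1) \<le> 3 * m\<^sup>2 / 4"
      using \<epsilon>(2) pos by (simp add: \<epsilon>0_def pos_less_divide_eq algebra_simps)
    then show "\<epsilon> * (6 * P\<^sup>2) \<le> 3 * m\<^sup>2 / 4"
      using \<epsilon>(1) by (simp add: algebra_simps)
    have l2: "(\<Sum>j = 0..5. (l x j)\<^sup>2) = 3 * (norm (gradient \<phi> x))\<^sup>2"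
      unfolding l_def norm_gradient_power2 by (rule hexagon_moment_2)
    show "\<bar>l x j\<bar> \<le> 2 * B" for j
      unfolding l_def using B[of "[_]"] xE by (intro bnd) auto
    show "\<bar>q x j\<bar> \<le> 2 * B" for j
    proof -
      have "\<bar>\<Sum>i\<in>UNIV. ?e j $ i * (\<Sum>k\<in>UNIV. ?e j $ k * partial_derivs [k, i] \<phi> x)\<bar> \<le> 2 * (2 * B)"
        using xE by (intro bnd B) auto
      then show ?thesis
        unfolding q_def by simp
    qed
    show "\<bar>\<phi> (x + hexagon_vertex \<epsilon> j) - \<phi> x - \<epsilon> * l x j - \<epsilon>\<^sup>2 * q x j\<bar> \<le> 4 * B / 3 * \<epsilon> ^ 3" for j
    proof -
      let ?v = "\<epsilon> *\<^sub>R ?e j"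
      have seg: "x + t *\<^sub>R ?v \<in> ?E" if "0 \<le> t" "t \<le> 1" for t
      proof -
        have "dist (x + t *\<^sub>R ?v) x = t * \<epsilon>"
          using that \<epsilon> by (simp add: dist_norm norm_hexagon_vertex)
        also have "\<dots> \<le> \<epsilon>"
          using that \<epsilon> by (simp add: mult_left_le_one_le)
        finally have "infdist (x + t *\<^sub>R ?v) \<Omega> < 1"
          using infdist_le[OF x, of "x + t *\<^sub>R ?v"] \<epsilon> \<epsilon>0 by linarith
        then show ?thesis
          by (simp add: unit_enlargement_def)
      qed
      have "\<bar>?v $ i\<bar> \<le> \<epsilon>" for i
        using e[of j i] \<epsilon> by (simp add: abs_mult mult_left_le)
      from taylor_second_order[OF E seg B this]
      have "\<bar>\<phi> (x + ?v) - \<phi> x - (\<Sum>i\<in>UNIV. ?v $ i * partial_deriv i \<phi> x)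
          - (\<Sum>i\<in>UNIV. ?v $ i * (\<Sum>k\<in>UNIV. ?v $ k * partial_derivs [k, i] \<phi> x)) / 2\<bar>
        \<le> 4 * B / 3 * \<epsilon> ^ 3"
        by (simp del: partial_derivs.simps)
      moreover have "(\<Sum>i\<in>UNIV. ?v $ i * partial_deriv i \<phi> x) = \<epsilon> * l x j"
        by (simp add: l_def sum_distrib_left mult_ac)
      moreover have "(\<Sum>i\<in>UNIV. ?v $ i * (\<Sum>k\<in>UNIV. ?v $ k * partial_derivs [k, i] \<phi> x)) / 2
          = \<epsilon>\<^sup>2 * q x j"
        by (simp add: q_def sum_distrib_left mult_ac power2_eq_square del: partial_derivs.simps)
      ultimately show ?thesis
        by (simp add: hexagon_vertex_scale[of \<epsilon>])
    qed
    show "(\<Sum>j = 0..5. l x j ^ 3) = 0"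
      unfolding l_def by (rule hexagon_moment_3)
    have "m \<le> norm (gradient \<phi> x)"
      using m(2) x closure_subset by blast
    then show "3 * m\<^sup>2 \<le> (\<Sum>j = 0..5. (l x j)\<^sup>2)"
      unfolding l2 using m(1) by (simp add: power_mono)
    have "(\<Sum>j = 0..5. (l x j)\<^sup>2 * q x j) = (\<Sum>j = 0..5. (l x j)\<^sup>2 * (2 * q x j)) / 2"
      by (simp add: sum_divide_distrib)
    also have "(\<Sum>j = 0..5. (l x j)\<^sup>2 * (2 * q x j)) = 3 / 4 *
      ((norm (gradient \<phi> x))\<^sup>2 * (\<Sum>i\<in>UNIV. partial_derivs [i, i] \<phi> x) + 2 *
       (\<Sum>i\<in>UNIV. partial_deriv i \<phi> x * (\<Sum>k\<in>UNIV. partial_deriv k \<phi> x * partial_derivs [i, k] \<phi> x)))"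
      unfolding l_def q_def norm_gradient_power2
      using hexagon_moment_4[of "\<lambda>i. partial_deriv i \<phi> x" "\<lambda>k i. partial_derivs [k, i] \<phi> x"] by simp
    also have "\<dots> = 3 * (game_laplacian 4 \<phi> x * (norm (gradient \<phi> x))\<^sup>2)"
      using game_laplacian_4[OF E xE] assms(6) xE by (simp del: partial_derivs.simps)
    finally show "game_laplacian 4 \<phi> x / 2 * (\<Sum>j = 0..5. (l x j)\<^sup>2) = (\<Sum>j = 0..5. (l x j)\<^sup>2 * q x j)"
      unfolding l2 by simp
    show "(\<Sum>j = 0..5. (\<phi> (x + hexagon_vertex \<epsilon> j) - \<phi> x - (hexagon_average4 \<epsilon> \<phi> x - \<phi> x)) ^ 3) = 0"
      using quartic_average_root[of "{0..5::nat}" "\<lambda>j. \<phi> (x + hexagon_vertex \<epsilon> j)"]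
      by (simp add: hexagon_average4_def)
  qed
  show ?thesis
  proof (rule uniform_limitI)
    fix \<delta> :: real assume \<delta>: "0 < \<delta>"
    define \<epsilon>1 where "\<epsilon>1 = min \<epsilon>0 (\<delta> / (\<bar>K\<bar> + 1))"
    have "0 < \<epsilon>1"
      using \<delta> \<epsilon>0 by (simp add: \<epsilon>1_def)
    then have "\<forall>\<^sub>F \<epsilon> in at_right 0. 0 < \<epsilon> \<and> \<epsilon> < \<epsilon>1"
      by (auto simp: eventually_at_right_field)
    then show "\<forall>\<^sub>F \<epsilon> in at_right 0. \<forall>x\<in>\<Omega>.
      dist ((\<phi> x - (hexagon_average4 \<epsilon> \<phi> x + 1 / 2 * \<epsilon>\<^sup>2 * (- game_laplacian 4 \<phi> x))) / \<epsilon>\<^sup>2) 0 < \<delta>"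
    proof eventually_elim
      case (elim \<epsilon>)
      show ?case
      proof
        fix x assume x: "x \<in> \<Omega>"
        let ?N = "\<phi> x - (hexagon_average4 \<epsilon> \<phi> x + 1 / 2 * \<epsilon>\<^sup>2 * (- game_laplacian 4 \<phi> x))"
        have "?N = - ((hexagon_average4 \<epsilon> \<phi> x - \<phi> x) - \<epsilon>\<^sup>2 * (game_laplacian 4 \<phi> x / 2))"
          by (simp add: algebra_simps)
        then have "\<bar>?N\<bar> \<le> K * \<epsilon> ^ 3"
          using main[of \<epsilon> x] elim x by (simp add: \<epsilon>1_def)
        then have "\<bar>?N\<bar> / \<epsilon>\<^sup>2 \<le> K * \<epsilon>"
          using elim by (simp add: field_simps eval_nat_numeral)
        also have "\<dots> \<le> \<epsilon> * (\<bar>K\<bar> + 1)"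
          unfolding mult.commute[of K] using elim by (intro mult_left_mono) auto
        also have "\<dots> < \<delta>"
          using elim by (simp add: \<epsilon>1_def field_simps)
        finally show "dist (?N / \<epsilon>\<^sup>2) 0 < \<delta>"
          by (simp add: dist_norm)
      qed
    qed
  qed
qed

end
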